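(* Let $S$ be a finite completely simple semigroup of order $n$. Then the Cayley table of $S$ is an equi-$n$-square; that is, for every $s\in S$ there are exactly $n$ pairs $(a,b)\in S\times S$ with $ab=s$.
   Context: A semigroup $S$ is simple if it has no (nonempty, two-sided) ideals other than itself. A simple semigroup is completely simple if it contains a primitive idempotent, i.e. an idempotent $e$ such that for every idempotent $f$ of the semigroup, $ef=fe=f\neq 0$ implies $e=f$ (the condition $f\ne 0$ being relevant only if there is a zero element). An equi-$n$-square is an $n\times n$ array on $n$ symbols in which each symbol occurs exactly $n$ times in the whole array; the elements of $S$ serve as the $n$ symbols. *)

theory Defs
  imports Main
begin

definition semigroup_ideal :: "'a::semigroup_mult set \<Rightarrow> bool" where
  "semigroup_ideal I \<longleftrightarrow> I \<noteq> {} \<and> (\<forall>x\<in>I. \<forall>s. s * x \<in> I \<and> x * s \<in> I)"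

definition zero_element :: "'a::semigroup_mult \<Rightarrow> bool" where
  "zero_element z \<longleftrightarrow> (\<forall>x. z * x = z \<and> x * z = z)"

definition idempotent_element :: "'a::semigroup_mult \<Rightarrow> bool" where
  "idempotent_element e \<longleftrightarrow> e * e = e"

(* If the semigroup has no zero element, the condition on zero elements is vacuous. *)
definition primitive_idempotent :: "'a::semigroup_mult \<Rightarrow> bool" where
  "primitive_idempotent e \<longleftrightarrow> idempotent_element e \<and>
     (\<forall>f. idempotent_element f \<and> e * f = f \<and> f * e = f \<and> \<not> zero_element f \<longrightarrow> e = f)"

(* The semigroup is the whole type; the itself argument only carries that type. *)
definition simple_semigroup :: "'a::semigroup_mult itself \<Rightarrow> bool" where
  "simple_semigroup _ \<longleftrightarrow> (\<forall>I :: 'a set. semigroup_ideal I \<longrightarrow> I = UNIV)"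

definition completely_simple_semigroup :: "'a::semigroup_mult itself \<Rightarrow> bool" where
  "completely_simple_semigroup T \<longleftrightarrow>
     simple_semigroup T \<and> (\<exists>e :: 'a. primitive_idempotent e)"

(* An array with rows indexed by R, columns indexed by C and symbol set X. *)
definition equi_square ::
    "nat \<Rightarrow> 'r set \<Rightarrow> 'c set \<Rightarrow> 'x set \<Rightarrow> ('r \<Rightarrow> 'c \<Rightarrow> 'x) \<Rightarrow> bool" where
  "equi_square n R C X A \<longleftrightarrow>
     finite R \<and> card R = n \<and> finite C \<and> card C = n \<and> finite X \<and> card X = n \<and>
     (\<forall>i\<in>R. \<forall>j\<in>C. A i j \<in> X) \<and>
     (\<forall>x\<in>X. card {(i, j) \<in> R \<times> C. A i j = x} = n)"

end

theory Submission
  imports Defs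
begin

text \<open>
  In a finite simple semigroup every right ideal \<open>aS\<close> contains \<open>a\<close> and is minimal, so that
  \<open>s \<in> aS\<close> iff \<open>a \<in> sS\<close> iff \<open>aS = sS\<close>. Right translations show that all fibres of the map
  \<open>b \<mapsto> ab\<close> from \<open>S\<close> onto \<open>aS\<close> have the same size \<open>n / card (aS)\<close>. Hence \<open>ab = s\<close> has
  \<open>n / card (sS)\<close> solutions \<open>b\<close> for each of the \<open>card (sS)\<close> elements \<open>a \<in> sS\<close>, and none for the
  other \<open>a\<close>.
\<close>

text \<open>The products \<open>p * a * q\<close> form an ideal, which simplicity forces to be
  everything.\<close>

lemma simple_semigroup_two_sided:
  fixes a x :: "'a::semigroup_mult"
  assumes "simple_semigroup TYPE('a)"
  obtains p q where "x = p * a * q"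
proof -
  let ?I = "{p * a * q | p q. True}"
  have "semigroup_ideal ?I"
    unfolding semigroup_ideal_def
  proof (intro conjI ballI allI)
    fix x s assume "x \<in> ?I"
    then obtain p q where x: "x = p * a * q" by blast
    have "s * x = (s * p) * a * q" "x * s = p * a * (q * s)"
      unfolding x by (simp_all add: mult.assoc)
    then show "s * x \<in> ?I" "x * s \<in> ?I" by blast+
  qed blast
  then have "?I = UNIV"
    using assms unfolding simple_semigroup_def by blast
  then show thesis using that by blast
qed

lemma finite_simple_right_cancel:
  fixes a x :: "'a::{semigroup_mult, finite}"
  assumes "simple_semigroup TYPE('a)"
  obtains y where "a * x * y = a"
proof -
  let ?A = "insert a (range ((*) a))" and ?B = "range ((*) (a * x))"
  obtain p q where pq: "a = p * (a * x) * q"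
    using simple_semigroup_two_sided[OF assms] .
  have "a = p * (a * x * q)"
    using pq by (simp only: mult.assoc)
  moreover have "a * s = p * (a * x * (q * s))" for s
    using arg_cong[OF pq, of "\<lambda>z. z * s"] by (simp only: mult.assoc)
  \<comment> \<open>Left translation by \<open>p\<close> maps the subset \<open>?B\<close> of \<open>?A\<close> onto a superset of \<open>?A\<close>, so by finiteness
    the two sets coincide.\<close>
  ultimately have "?A \<subseteq> (*) p ` ?B" by blast
  then have "card ?A \<le> card ?B"
    by (meson card_image_le card_mono finite order_trans)
  moreover have "?B \<subseteq> ?A" by (auto simp: mult.assoc)
  ultimately have "?B = ?A" by (simp add: card_seteq)
  then have "a \<in> ?B" by simp
  then obtain y where "a = a * x * y" by blast
  then show thesis by (rule that[OF sym])
qed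

lemma finite_simple_left_cancel:
  fixes a x :: "'a::{semigroup_mult, finite}"
  assumes "simple_semigroup TYPE('a)"
  obtains y where "y * x * a = a"
proof -
  let ?A = "insert a (range (\<lambda>s. s * a))" and ?B = "range (\<lambda>s. s * (x * a))"
  obtain p q where pq: "a = p * (x * a) * q"
    using simple_semigroup_two_sided[OF assms] .
  have "s * a = ((s * p) * (x * a)) * q" for s
    using arg_cong[OF pq, of "\<lambda>z. s * z"] by (simp only: mult.assoc)
  \<comment> \<open>Mirror image of the argument for right ideals: right translation by
    \<open>q\<close> now covers \<open>?A\<close> from \<open>?B\<close>.\<close>
  with pq have "?A \<subseteq> (\<lambda>b. b * q) ` ?B" by blast
  then have "card ?A \<le> card ?B"
    by (meson card_image_le card_mono finite order_trans)
  moreover have "?B \<subseteq> ?A" by (auto simp flip: mult.assoc)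
  ultimately have "?B = ?A" by (simp add: card_seteq)
  then have "a \<in> ?B" by simp
  then obtain y where "a = y * (x * a)" by blast
  then have "y * x * a = a" by (simp only: mult.assoc)
  then show thesis by (rule that)
qed

text \<open>Minimality of right ideals: if \<open>s = a * b\<close>, some \<open>y\<close> undoes
  right multiplication of \<open>a\<close> by \<open>b\<close>, which gives the nontrivial
  inclusion.\<close>

lemma finite_simple_right_ideal_eq:
  fixes a s :: "'a::{semigroup_mult, finite}"
  assumes "simple_semigroup TYPE('a)" and "s \<in> range ((*) a)"
  shows "range ((*) s) = range ((*) a)"
proof -
  obtain b where s: "s = a * b" using assms(2) by blast
  obtain y where "a * b * y = a" using finite_simple_right_cancel[OF assms(1)] .
  then have "a * c = s * (y * c)" for c
    unfolding s by (simp flip: mult.assoc)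
  moreover have "s * c = a * (b * c)" for c
    unfolding s by (rule mult.assoc)
  ultimately show ?thesis by blast
qed

lemma finite_simple_right_ideal_self:
  fixes a :: "'a::{semigroup_mult, finite}"
  assumes "simple_semigroup TYPE('a)"
  shows "a \<in> range ((*) a)"
proof -
  obtain y where "a * a * y = a" using finite_simple_right_cancel[OF assms] .
  then have "a = a * (a * y)" by (simp only: mult.assoc)
  then show ?thesis by blast
qed

text \<open>Since \<open>s\<close> and \<open>t\<close> generate the same right ideal,
  \<open>s = t * u\<close> for some \<open>u\<close>, and right translation by \<open>u\<close>
  embeds the fibre over \<open>t\<close> into the fibre over \<open>s\<close>.\<close>

lemma finite_simple_fibre_card_le:
  fixes a s t :: "'a::{semigroup_mult, finite}"
  assumes simple: "simple_semigroup TYPE('a)"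
    and "s \<in> range ((*) a)" "t \<in> range ((*) a)"
  shows "card {b. a * b = t} \<le> card {b. a * b = s}"
proof -
  have "s \<in> range ((*) t)"
    using assms finite_simple_right_ideal_eq by blast
  then obtain u where u: "s = t * u" by blast
  have "inj_on (\<lambda>b. b * u) {b. a * b = t}"
  proof (rule inj_onI, clarsimp)
    fix b b' assume bb': "a * b' = a * b" "b * u = b' * u"
    obtain y where y: "b * u * y = b"
      using finite_simple_right_cancel[OF simple] .
    obtain z where z: "z * a * b' = b'"
      using finite_simple_left_cancel[OF simple] .
    \<comment> \<open>Here \<open>u * y\<close> fixes \<open>b\<close> from the right and
      \<open>z * a\<close> fixes \<open>b'\<close> from the left; regrouping shows that
      \<open>z * a\<close> fixes \<open>b\<close> too, and \<open>a * b = a * b'\<close> then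
      identifies the two.\<close>
    have "b = z * a * b' * u * y" unfolding z bb'(2)[symmetric] y ..
    also have "\<dots> = z * a * (b' * u * y)" by (simp only: mult.assoc)
    also have "\<dots> = z * a * b" unfolding bb'(2)[symmetric] y ..
    also have "\<dots> = z * a * b'" using bb'(1) by (simp only: mult.assoc)
    finally show "b = b'" using z by simp
  qed
  moreover have "(\<lambda>b. b * u) ` {b. a * b = t} \<subseteq> {b. a * b = s}"
    using u by (auto simp flip: mult.assoc)
  ultimately show ?thesis by (simp add: card_inj_on_le)
qed

lemma finite_simple_fibre_card:
  fixes a s :: "'a::{semigroup_mult, finite}"
  assumes "simple_semigroup TYPE('a)" and "s \<in> range ((*) a)"
  shows "card (range ((*) a)) * card {b. a * b = s} = card (UNIV :: 'a set)"
proof -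
  have "card (UNIV :: 'a set) = (\<Sum>t\<in>range ((*) a). card {b. a * b = t})"
    using sum.image_gen[of UNIV "\<lambda>_. 1 :: nat" "(*) a"] by simp
  \<comment> \<open>The fibre inequality applies in both directions, as \<open>s\<close> and
    \<open>t\<close> both lie in the image.\<close>
  also have "\<dots> = (\<Sum>t\<in>range ((*) a). card {b. a * b = s})"
    by (intro sum.cong refl antisym finite_simple_fibre_card_le assms)
  finally show ?thesis by simp
qed

lemma finite_simple_card_factorizations:
  fixes s :: "'a::{semigroup_mult, finite}"
  assumes simple: "simple_semigroup TYPE('a)"
  shows "card {(a, b). a * b = s} = card (UNIV :: 'a set)"
proof -
  let ?R = "range ((*) s)"
  have mem_iff: "s \<in> range ((*) a) \<longleftrightarrow> a \<in> ?R" for a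
    using finite_simple_right_ideal_eq[OF simple] finite_simple_right_ideal_self[OF simple]
    by metis
  have fibre: "card ?R * card {b. a * b = s} = card (UNIV :: 'a set)" if "a \<in> ?R" for a
    using finite_simple_fibre_card[OF simple mem_iff[THEN iffD2, OF that]]
    unfolding finite_simple_right_ideal_eq[OF simple that] .
  have "{(a, b). a * b = s} = (SIGMA a:?R. {b. a * b = s})"
    using mem_iff[THEN iffD1, OF range_eqI[OF sym]] by auto
  then have "card {(a, b). a * b = s} = (\<Sum>a\<in>?R. card {b. a * b = s})"
    by simp
  \<comment> \<open>Scaling by \<open>card ?R\<close> avoids division: each of the
    \<open>card ?R\<close> summands becomes the order of the semigroup.\<close>
  then have "card ?R * card {(a, b). a * b = s} = card ?R * card (UNIV :: 'a set)"
    by (simp add: sum_distrib_left fibre)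
  moreover have "card ?R \<noteq> 0" by simp
  ultimately show ?thesis by (metis mult_cancel1)
qed

theorem theorem1p4:
  fixes n :: nat
  assumes "completely_simple_semigroup TYPE('a::{semigroup_mult, finite})"
    and "card (UNIV :: 'a set) = n"
  shows "equi_square n (UNIV :: 'a set) (UNIV :: 'a set) (UNIV :: 'a set) (\<lambda>a b. a * b) \<and>
         (\<forall>s :: 'a. card {(a, b). a * b = s} = n)"
proof -
  have "simple_semigroup TYPE('a)"
    using assms(1) by (simp add: completely_simple_semigroup_def)
  then have "card {(a, b). a * b = s} = n" for s :: 'a
    using finite_simple_card_factorizations assms(2) by metis
  then show ?thesis
    using assms(2) by (simp add: equi_square_def)
qed

end
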